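(* The $k$-$d$-Bichromatic-Rectangle problem is W[1]-hard when parameterized with both the dimension $d$ and the size of the solution $k$.
   Context: Points have rational coordinates. W[1]-hardness is with respect to fpt-reductions: many-one reductions computable in time $O(f(k)\cdot n^{c})$ ($f$ computable, $c$ constant) from a problem with parameter $k$ to a problem with parameter $k'$ such that $k'\le g(k)$ for a computable $g$. ($k$-Clique, parameterized by $k$, is W[1]-complete.) $k$-$d$-Bichromatic-Rectangle: given a finite set $P_r$ of red points and a finite set $P_b$ of blue points in $\mathbb{R}^d$, and $k\in\mathbb{N}$, decide whether there is an axis-parallel box $H$ such that $H\cap P_r=\emptyset$ and $|H\cap P_b|\ge k$. *)

theory Defs
  imports Complex_Main
begin

section \<open>Model of computation\<close>

text \<open>
  Inputs and outputs are binary trees over a single atom, and programs are WHILE programs over such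
  trees, in the style of N. D. Jones, \<^emph>\<open>Computability and Complexity: From a Programming
  Perspective\<close> (MIT Press, 1997). A tree with \<open>n\<close> nodes amounts to a bit string of length \<open>n\<close> (its
  preorder listing), so a set of trees is a language in the usual sense.
\<close>

datatype sexp = Atom | Dot sexp sexp

fun nodes :: "sexp \<Rightarrow> nat" where
  "nodes Atom = 1"
| "nodes (Dot a b) = 1 + nodes a + nodes b"

fun car :: "sexp \<Rightarrow> sexp" where
  "car Atom = Atom"
| "car (Dot a b) = a"

fun cdr :: "sexp \<Rightarrow> sexp" where
  "cdr Atom = Atom"
| "cdr (Dot a b) = b"

datatype prog =
    Ident | Erase | Car | Cdr
  | Build prog prog
  | Seq prog prog
  | Cond prog prog prog
  | Loop prog prog

text \<open>
  \<open>exec p x y t\<close>: on input \<open>x\<close>, program \<open>p\<close> halts with output \<open>y\<close> at cost \<open>t\<close>. A primitive step is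
  charged the size of the tree it handles, not unit cost. With unit cost, repeatedly pairing a tree
  with itself would produce outputs exponentially larger than the running time; with the present
  costs every tree that is read, copied or produced is paid for (see \<open>exec_nodes\<close>), so that this
  notion of time is polynomially related to that of Turing machines.
\<close>

inductive exec :: "prog \<Rightarrow> sexp \<Rightarrow> sexp \<Rightarrow> nat \<Rightarrow> bool" where
  exec_Ident: "exec Ident x x (1 + nodes x)"
| exec_Erase: "exec Erase x Atom (1 + nodes x)"
| exec_Car: "exec Car x (car x) (1 + nodes x)"
| exec_Cdr: "exec Cdr x (cdr x) (1 + nodes x)"
| exec_Build: "exec p x y s \<Longrightarrow> exec q x z t \<Longrightarrow> exec (Build p q) x (Dot y z) (1 + s + t)"
| exec_Seq: "exec p x y s \<Longrightarrow> exec q y z t \<Longrightarrow> exec (Seq p q) x z (1 + s + t)"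
| exec_Cond_True: "exec p x b s \<Longrightarrow> b \<noteq> Atom \<Longrightarrow> exec q x y t \<Longrightarrow>
    exec (Cond p q r) x y (1 + s + t)"
| exec_Cond_False: "exec p x Atom s \<Longrightarrow> exec r x y t \<Longrightarrow> exec (Cond p q r) x y (1 + s + t)"
| exec_Loop_Stop: "exec p x Atom s \<Longrightarrow> exec (Loop p q) x x (1 + s)"
| exec_Loop_Step: "exec p x b s \<Longrightarrow> b \<noteq> Atom \<Longrightarrow> exec q x y t \<Longrightarrow> exec (Loop p q) y z u \<Longrightarrow>
    exec (Loop p q) x z (1 + s + t + u)"

lemma exec_nodes: "exec p x y t \<Longrightarrow> nodes x \<le> t \<and> nodes y \<le> t"
proof (induction rule: exec.induct)
  case (exec_Car x) then show ?case by (cases x) auto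
next
  case (exec_Cdr x) then show ?case by (cases x) auto
qed auto

inductive_cases exec_primE:
  "exec Ident x y t" "exec Erase x y t" "exec Car x y t" "exec Cdr x y t"
inductive_cases exec_BuildE: "exec (Build p q) x y t"
inductive_cases exec_SeqE: "exec (Seq p q) x y t"
inductive_cases exec_CondE: "exec (Cond p q r) x y t"
inductive_cases exec_LoopE: "exec (Loop p q) x y t"

lemma exec_deterministic: "exec p x y t \<Longrightarrow> exec p x y' t' \<Longrightarrow> y = y' \<and> t = t'"
proof (induction arbitrary: y' t' rule: exec.induct)
  case (exec_Build p x y s q z t)
  from exec_Build.prems show ?case
    by (rule exec_BuildE) (auto dest!: exec_Build.IH)
next
  case (exec_Seq p x y s q z t)
  from exec_Seq.prems show ?case
    by (rule exec_SeqE) (auto dest!: exec_Seq.IH(1) dest: exec_Seq.IH(2))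
next
  case (exec_Cond_True p x b s q y t r)
  from exec_Cond_True.prems show ?case
    by (rule exec_CondE) (use exec_Cond_True.hyps in \<open>auto dest!: exec_Cond_True.IH\<close>)
next
  case (exec_Cond_False p x s r y t q)
  from exec_Cond_False.prems show ?case
    by (rule exec_CondE) (auto dest!: exec_Cond_False.IH)
next
  case (exec_Loop_Stop p x s q)
  from exec_Loop_Stop.prems show ?case
    by (rule exec_LoopE) (auto dest!: exec_Loop_Stop.IH)
next
  case (exec_Loop_Step p x b s q y t z u)
  from exec_Loop_Step.prems show ?case
  proof (rule exec_LoopE)
    fix s' assume "exec p x Atom s'"
    then show ?thesis using exec_Loop_Step.IH(1) exec_Loop_Step.hyps(2) by blast
  next
    fix b' s' y2 t2 u'
    assume *: "t' = Suc (s' + t2 + u')" "exec p x b' s'" "exec q x y2 t2" "exec (Loop p q) y2 y' u'"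
    have "s = s'" "y = y2" "t = t2"
      using exec_Loop_Step.IH(1,2) * by blast+
    moreover have "z = y' \<and> u = u'"
      using exec_Loop_Step.IH(3) * \<open>y = y2\<close> by blast
    ultimately show ?thesis using * by simp
  qed
qed (auto elim: exec_primE)


section \<open>Representation of numbers and lists\<close>

text \<open>
  Objects are represented through total decoding functions, so that every tree is a representation.
  As usual, leading zeros and fractions that are not in lowest terms are tolerated.
\<close>

fun dec_list :: "sexp \<Rightarrow> sexp list" where
  "dec_list Atom = []"
| "dec_list (Dot a b) = a # dec_list b"

definition dec_bool :: "sexp \<Rightarrow> bool" where
  "dec_bool x \<longleftrightarrow> x \<noteq> Atom"

text \<open>Binary numerals, least significant bit first.\<close>

fun dec_nat :: "sexp \<Rightarrow> nat" where
  "dec_nat Atom = 0"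
| "dec_nat (Dot a b) = of_bool (dec_bool a) + 2 * dec_nat b"

text \<open>Sign and absolute value.\<close>

definition dec_int :: "sexp \<Rightarrow> int" where
  "dec_int x = (if dec_bool (car x) then - int (dec_nat (cdr x)) else int (dec_nat (cdr x)))"

text \<open>Numerator and denominator; a zero denominator yields 0.\<close>

definition dec_rat :: "sexp \<Rightarrow> rat" where
  "dec_rat x = of_int (dec_int (car x)) / of_nat (dec_nat (cdr x))"

lemma surj_dec_list: "surj dec_list"
proof -
  have "\<exists>x. dec_list x = xs" for xs
  proof (induction xs)
    case Nil
    show ?case by (rule exI[of _ Atom]) simp
  next
    case (Cons a xs)
    then show ?case by (metis dec_list.simps(2))
  qed
  then show ?thesis by (metis surjI)
qed

lemma surj_dec_nat: "surj dec_nat"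
proof -
  have "\<exists>x. dec_nat x = n" for n
  proof (induction n rule: less_induct)
    case (less n)
    show ?case
    proof (cases "n = 0")
      case True
      then show ?thesis by (metis dec_nat.simps(1))
    next
      case False
      then obtain x where "dec_nat x = n div 2"
        using less[of "n div 2"] by auto
      then have "dec_nat (Dot (if odd n then Dot Atom Atom else Atom) x) = n"
        by (auto simp: dec_bool_def)
      then show ?thesis ..
    qed
  qed
  then show ?thesis by (metis surjI)
qed

lemma surj_dec_int: "surj dec_int"
proof -
  have "\<exists>x. dec_int x = i" for i
  proof -
    obtain m where m: "dec_nat m = nat \<bar>i\<bar>"
      using surj_dec_nat by (metis surj_def)
    have "dec_int (Dot (if i < 0 then Dot Atom Atom else Atom) m) = i"
      using m by (auto simp: dec_int_def dec_bool_def)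
    then show ?thesis ..
  qed
  then show ?thesis by (metis surjI)
qed

lemma surj_dec_rat: "surj dec_rat"
proof -
  have "\<exists>x. dec_rat x = q" for q
  proof -
    obtain a b where ab: "q = Fract a b" "b > 0"
      by (cases q) auto
    obtain x where x: "dec_int x = a"
      using surj_dec_int by (metis surj_def)
    obtain y where y: "dec_nat y = nat b"
      using surj_dec_nat by (metis surj_def)
    have "dec_rat (Dot x y) = q"
      using ab x y by (simp add: dec_rat_def Fract_of_int_quotient)
    then show ?thesis ..
  qed
  then show ?thesis by (metis surjI)
qed


section \<open>Parameterized complexity\<close>

definition computable_nat :: "(nat \<Rightarrow> nat) \<Rightarrow> bool" where
  "computable_nat f \<longleftrightarrow> (\<exists>p. \<forall>x. \<exists>y t. exec p x y t \<and> dec_nat y = f (dec_nat x))"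

text \<open>A problem with parameter: the yes-instances, and the parameter of each instance.\<close>

type_synonym param_problem = "sexp set \<times> (sexp \<Rightarrow> nat)"

definition poly_time_parameter :: "(sexp \<Rightarrow> nat) \<Rightarrow> bool" where
  "poly_time_parameter \<kappa> \<longleftrightarrow>
     (\<exists>p a c. \<forall>x. \<exists>y t. exec p x y t \<and> dec_nat y = \<kappa> x \<and> t \<le> a * nodes x ^ c)"

definition fpt_time_computable :: "(sexp \<Rightarrow> nat) \<Rightarrow> (sexp \<Rightarrow> sexp) \<Rightarrow> bool" where
  "fpt_time_computable \<kappa> R \<longleftrightarrow>
     (\<exists>p f a c. computable_nat f \<and>
        (\<forall>x. \<exists>t. exec p x (R x) t \<and> t \<le> a * (f (\<kappa> x) * nodes x ^ c)))"

definition fpt_reducible :: "param_problem \<Rightarrow> param_problem \<Rightarrow> bool" where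
  "fpt_reducible P Q \<longleftrightarrow>
     (\<exists>R. (\<forall>x. x \<in> fst P \<longleftrightarrow> R x \<in> fst Q) \<and>
          fpt_time_computable (snd P) R \<and>
          (\<exists>g. computable_nat g \<and> (\<forall>x. snd Q (R x) \<le> g (snd P x))))"

definition is_clique :: "nat set set \<Rightarrow> nat set \<Rightarrow> bool" where
  "is_clique E S \<longleftrightarrow> (\<forall>u\<in>S. \<forall>v\<in>S. u \<noteq> v \<longrightarrow> {u, v} \<in> E)"

text \<open>
  A simple graph is given by an adjacency matrix, a list of rows. The vertices are the row indices.
  The diagonal is ignored, entries missing at the end of a row count as false, and \<open>u\<close>, \<open>v\<close> are
  adjacent if at least one of the two corresponding entries is true.
\<close>

definition graph_vertices :: "sexp \<Rightarrow> nat set" where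
  "graph_vertices x = {..<length (dec_list x)}"

definition graph_edges :: "sexp \<Rightarrow> nat set set" where
  "graph_edges x =
     (let M = map (map dec_bool \<circ> dec_list) (dec_list x)
      in {{u, v} |u v. u \<in> graph_vertices x \<and> v \<in> graph_vertices x \<and> u \<noteq> v \<and>
                       v < length (M ! u) \<and> M ! u ! v})"

text \<open>Instances of \<open>k\<close>-Clique are pairs of \<open>k\<close> and a graph; the parameter is \<open>k\<close>.\<close>

definition k_Clique :: param_problem where
  "k_Clique =
     ({x. \<exists>S \<subseteq> graph_vertices (cdr x).
            card S = dec_nat (car x) \<and> is_clique (graph_edges (cdr x)) S},
      \<lambda>x. dec_nat (car x))"

text \<open>
  \<open>W[1]\<close> is taken to be the closure of \<open>k\<close>-Clique under fpt-reductions, which is the standard class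
  because \<open>k\<close>-Clique is complete for it.
\<close>

definition W1 :: "param_problem set" where
  "W1 = {P. poly_time_parameter (snd P) \<and> fpt_reducible P k_Clique}"

definition W1_hard :: "param_problem \<Rightarrow> bool" where
  "W1_hard Q \<longleftrightarrow> (\<forall>P\<in>W1. fpt_reducible P Q)"


section \<open>The bichromatic rectangle problem\<close>

text \<open>
  The dimension is part of the input, so points of \<open>d\<close>-dimensional space are lists of length \<open>d\<close>.
\<close>

definition axis_parallel_box :: "nat \<Rightarrow> real list set \<Rightarrow> bool" where
  "axis_parallel_box d H \<longleftrightarrow>
     (\<exists>a b. length a = d \<and> length b = d \<and> (\<forall>i<d. a ! i \<le> b ! i) \<and>
            H = {x. length x = d \<and> (\<forall>i<d. a ! i \<le> x ! i \<and> x ! i \<le> b ! i)})"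

definition has_bichromatic_rectangle ::
  "nat \<Rightarrow> real list set \<Rightarrow> real list set \<Rightarrow> nat \<Rightarrow> bool" where
  "has_bichromatic_rectangle d P\<^sub>r P\<^sub>b k \<longleftrightarrow>
     (\<exists>H. axis_parallel_box d H \<and> H \<inter> P\<^sub>r = {} \<and> k \<le> card (H \<inter> P\<^sub>b))"

definition dec_points :: "sexp \<Rightarrow> real list set" where
  "dec_points x = set (map (map (of_rat \<circ> dec_rat) \<circ> dec_list) (dec_list x))"

text \<open>
  An instance consists of \<open>k\<close>, \<open>d\<close>, the red points and the blue points. An input with a point that
  does not have exactly \<open>d\<close> coordinates is malformed and rejected. Parameterizing with both \<open>d\<close> and
  \<open>k\<close> means that the parameter is \<open>d + k\<close>.
\<close>

definition k_d_Bichromatic_Rectangle :: param_problem where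
  "k_d_Bichromatic_Rectangle =
     ({x. let k = dec_nat (car x); d = dec_nat (car (cdr x));
              P\<^sub>r = dec_points (car (cdr (cdr x))); P\<^sub>b = dec_points (cdr (cdr (cdr x)))
          in (\<forall>p \<in> P\<^sub>r \<union> P\<^sub>b. length p = d) \<and> has_bichromatic_rectangle d P\<^sub>r P\<^sub>b k},
      \<lambda>x. dec_nat (car (cdr x)) + dec_nat (car x))"

end

theory Submission
  imports Defs
begin

text \<open>
  The reduction is from \<open>k\<close>-Clique, with dimension \<open>2 k\<close>: every slot of the clique owns a coordinate
  plane, in which the vertices are represented by blue points on the hyperbola \<open>x y = 1\<close>. Red points
  just outside the hyperbola prevent a box from containing two blue points of the same plane, so that
  a box with \<open>k\<close> blue points selects one vertex for each slot. For two non-adjacent or equal vertices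
  in different planes, the sum of their blue points is red, and it lies in every box that contains
  both of them. Hence the selected vertices form a clique.

  This takes polynomial time once \<open>k\<close> is at most the number of vertices. Programs are obtained from
  closure properties of polynomial time, the main one being iteration over a list with
  intermediate results of polynomial size.
\<close>

section \<open>Polynomial-time functions on trees\<close>

definition poly_bounded :: "(sexp \<Rightarrow> nat) \<Rightarrow> bool" where
  "poly_bounded b \<longleftrightarrow> (\<exists>a c. \<forall>x. b x \<le> a * nodes x ^ c)"

text \<open>The bound is an arbitrary polynomially bounded function, so that sums and compositions
  of bounds can be used as they arise; \<open>poly_timeE\<close> recovers a single monomial.\<close>

definition poly_time :: "(sexp \<Rightarrow> sexp) \<Rightarrow> bool" where
  "poly_time F \<longleftrightarrow> (\<exists>p b. poly_bounded b \<and> (\<forall>x. \<exists>t. exec p x (F x) t \<and> t \<le> b x))"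

section \<open>Arithmetic of polynomial bounds\<close>

lemma nodes_pos: "1 \<le> nodes x"
  by (cases x) auto

lemma poly_boundedI: "(\<And>x. b x \<le> a * nodes x ^ c) \<Longrightarrow> poly_bounded b"
  unfolding poly_bounded_def by blast

lemma poly_bounded_mono: "poly_bounded b \<Longrightarrow> (\<And>x. b' x \<le> b x) \<Longrightarrow> poly_bounded b'"
  unfolding poly_bounded_def by (meson order_trans)

lemma poly_bounded_const: "poly_bounded (\<lambda>x. m)"
  by (rule poly_boundedI[of _ m 0]) simp

lemma poly_bounded_nodes: "poly_bounded (\<lambda>x. nodes x)"
  by (rule poly_boundedI[of _ 1 1]) simp

lemma poly_bounded_add:
  assumes "poly_bounded b" "poly_bounded b'"
  shows "poly_bounded (\<lambda>x. b x + b' x)"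
proof -
  obtain a c a' c' where b: "\<And>x. b x \<le> a * nodes x ^ c" "\<And>x. b' x \<le> a' * nodes x ^ c'"
    using assms unfolding poly_bounded_def by blast
  show ?thesis
  proof (rule poly_boundedI)
    fix x
    have "nodes x ^ c \<le> nodes x ^ (c + c')" "nodes x ^ c' \<le> nodes x ^ (c + c')"
      by (rule power_increasing, simp, rule nodes_pos)+
    then have "a * nodes x ^ c + a' * nodes x ^ c' \<le> (a + a') * nodes x ^ (c + c')"
      by (simp add: distrib_right add_mono)
    then show "b x + b' x \<le> (a + a') * nodes x ^ (c + c')"
      using b[of x] by linarith
  qed
qed

lemma poly_bounded_mult:
  assumes "poly_bounded b" "poly_bounded b'"
  shows "poly_bounded (\<lambda>x. b x * b' x)"
proof -
  obtain a c a' c' where b: "\<And>x. b x \<le> a * nodes x ^ c" "\<And>x. b' x \<le> a' * nodes x ^ c'"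
    using assms unfolding poly_bounded_def by blast
  show ?thesis
  proof (rule poly_boundedI)
    fix x
    have "b x * b' x \<le> (a * nodes x ^ c) * (a' * nodes x ^ c')"
      by (rule mult_mono[OF b]) auto
    then show "b x * b' x \<le> (a * a') * nodes x ^ (c + c')"
      by (simp add: power_add mult_ac)
  qed
qed

lemma poly_bounded_power: "poly_bounded b \<Longrightarrow> poly_bounded (\<lambda>x. b x ^ m)"
  by (induction m) (auto intro: poly_bounded_const poly_bounded_mult)

lemma poly_bounded_comp:
  assumes "poly_bounded b" "poly_bounded (\<lambda>x. nodes (F x))"
  shows "poly_bounded (\<lambda>x. b (F x))"
proof -
  obtain a c where b: "\<And>x. b x \<le> a * nodes x ^ c"
    using assms(1) unfolding poly_bounded_def by blast
  have "poly_bounded (\<lambda>x. a * nodes (F x) ^ c)"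
    by (intro poly_bounded_mult poly_bounded_const poly_bounded_power assms(2))
  then show ?thesis
    using b by (rule poly_bounded_mono)
qed

section \<open>Closure of polynomial time under composition, pairing and case distinction\<close>

lemma poly_timeI:
  assumes "poly_bounded b" "\<And>x. \<exists>t. exec p x (F x) t \<and> t \<le> b x"
  shows "poly_time F"
  using assms unfolding poly_time_def by blast

lemma poly_timeE:
  assumes "poly_time F"
  obtains p a c where "\<And>x. \<exists>t. exec p x (F x) t \<and> t \<le> a * nodes x ^ c"
  using assms unfolding poly_time_def poly_bounded_def by (meson order_trans)

text \<open>The cost model charges for every tree that is produced, so the running time bounds the
  output size. This makes polynomial time closed under composition.\<close>

lemma poly_time_nodes:
  assumes "poly_time F"
  shows "poly_bounded (\<lambda>x. nodes (F x))"
  using assms unfolding poly_time_def by (metis exec_nodes order_trans poly_bounded_mono)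

lemma poly_time_comp:
  assumes "poly_time F" "poly_time G"
  shows "poly_time (\<lambda>x. F (G x))"
proof -
  obtain p b where p: "poly_bounded b" "\<And>x. \<exists>t. exec p x (F x) t \<and> t \<le> b x"
    using assms(1) unfolding poly_time_def by blast
  obtain q b' where q: "poly_bounded b'" "\<And>x. \<exists>t. exec q x (G x) t \<and> t \<le> b' x"
    using assms(2) unfolding poly_time_def by blast
  show ?thesis
  proof (rule poly_timeI)
    show "poly_bounded (\<lambda>x. 1 + b' x + b (G x))"
      by (intro poly_bounded_add poly_bounded_const q(1) poly_bounded_comp[OF p(1)]
          poly_time_nodes assms(2))
    fix x
    obtain s t where "exec q x (G x) s" "s \<le> b' x" "exec p (G x) (F (G x)) t" "t \<le> b (G x)"
      using p(2) q(2) by blast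
    then show "\<exists>t. exec (Seq q p) x (F (G x)) t \<and> t \<le> 1 + b' x + b (G x)"
      by (intro exI[of _ "1 + s + t"] conjI exec_Seq) auto
  qed
qed

lemma poly_time_prim:
  assumes "\<And>x. exec p x (F x) (1 + nodes x)"
  shows "poly_time F"
proof (rule poly_timeI)
  show "poly_bounded (\<lambda>x. 1 + nodes x)"
    by (intro poly_bounded_add poly_bounded_const poly_bounded_nodes)
qed (use assms in blast)

lemma poly_time_id: "poly_time (\<lambda>x. x)"
  by (rule poly_time_prim) (rule exec_Ident)

lemma poly_time_car: "poly_time F \<Longrightarrow> poly_time (\<lambda>x. car (F x))"
  by (rule poly_time_comp[OF poly_time_prim]) (rule exec_Car)

lemma poly_time_cdr: "poly_time F \<Longrightarrow> poly_time (\<lambda>x. cdr (F x))"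
  by (rule poly_time_comp[OF poly_time_prim]) (rule exec_Cdr)

lemma poly_time_Dot:
  assumes "poly_time F" "poly_time G"
  shows "poly_time (\<lambda>x. Dot (F x) (G x))"
proof -
  obtain p b where p: "poly_bounded b" "\<And>x. \<exists>t. exec p x (F x) t \<and> t \<le> b x"
    using assms(1) unfolding poly_time_def by blast
  obtain q b' where q: "poly_bounded b'" "\<And>x. \<exists>t. exec q x (G x) t \<and> t \<le> b' x"
    using assms(2) unfolding poly_time_def by blast
  show ?thesis
  proof (rule poly_timeI)
    show "poly_bounded (\<lambda>x. 1 + b x + b' x)"
      by (intro poly_bounded_add poly_bounded_const p(1) q(1))
    fix x
    obtain s t where "exec p x (F x) s" "s \<le> b x" "exec q x (G x) t" "t \<le> b' x"
      using p(2) q(2) by blast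
    then show "\<exists>t. exec (Build p q) x (Dot (F x) (G x)) t \<and> t \<le> 1 + b x + b' x"
      by (intro exI[of _ "1 + s + t"] conjI exec_Build) auto
  qed
qed

lemma poly_time_const: "poly_time (\<lambda>x. y)"
proof (induction y)
  case Atom
  show ?case by (rule poly_time_prim) (rule exec_Erase)
qed (rule poly_time_Dot)

lemma poly_time_If:
  assumes "poly_time C" "poly_time F" "poly_time G"
  shows "poly_time (\<lambda>x. if C x \<noteq> Atom then F x else G x)"
proof -
  obtain p b where p: "poly_bounded b" "\<And>x. \<exists>t. exec p x (C x) t \<and> t \<le> b x"
    using assms(1) unfolding poly_time_def by blast
  obtain q b' where q: "poly_bounded b'" "\<And>x. \<exists>t. exec q x (F x) t \<and> t \<le> b' x"
    using assms(2) unfolding poly_time_def by blast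
  obtain r b'' where r: "poly_bounded b''" "\<And>x. \<exists>t. exec r x (G x) t \<and> t \<le> b'' x"
    using assms(3) unfolding poly_time_def by blast
  show ?thesis
  proof (rule poly_timeI)
    show "poly_bounded (\<lambda>x. 1 + b x + (b' x + b'' x))"
      by (intro poly_bounded_add poly_bounded_const p(1) q(1) r(1))
    fix x
    obtain s t u where *: "exec p x (C x) s" "s \<le> b x" "exec q x (F x) t" "t \<le> b' x"
      "exec r x (G x) u" "u \<le> b'' x"
      using p(2) q(2) r(2) by blast
    show "\<exists>t. exec (Cond p q r) x (if C x \<noteq> Atom then F x else G x) t \<and>
        t \<le> 1 + b x + (b' x + b'' x)"
    proof (cases "C x = Atom")
      case True
      then show ?thesis
        using * exec_Cond_False[of p x s r "G x" u q] by (intro exI[of _ "1 + s + u"]) auto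
    next
      case False
      then show ?thesis
        using * exec_Cond_True[of p x "C x" s q "F x" t r] by (intro exI[of _ "1 + s + t"]) auto
    qed
  qed
qed

lemmas poly_time_basic =
  poly_time_id poly_time_const poly_time_car poly_time_cdr poly_time_Dot poly_time_If

section \<open>Lists as trees and iteration over them\<close>

fun enc_list :: "sexp list \<Rightarrow> sexp" where
  "enc_list [] = Atom"
| "enc_list (a # l) = Dot a (enc_list l)"

lemma dec_enc_list [simp]: "dec_list (enc_list l) = l"
  by (induction l) auto

lemma enc_dec_list [simp]: "enc_list (dec_list x) = x"
  by (induction x) auto

lemma enc_list_eq_Atom [simp]: "enc_list l = Atom \<longleftrightarrow> l = []"
  by (cases l) auto

lemma nodes_enc_list: "nodes (enc_list l) = 1 + (\<Sum>a\<leftarrow>l. 1 + nodes a)"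
  by (induction l) auto

lemma nodes_member_list: "a \<in> set (dec_list x) \<Longrightarrow> nodes a \<le> nodes x"
  by (induction x) auto

lemma length_dec_list: "length (dec_list x) \<le> nodes x"
  by (induction x) auto

text \<open>A loop works on states \<open>Dot x (Dot rest acc)\<close>, with the input
  \<open>x\<close> carried along since the step may depend on it. A polynomial-time step alone is
  not enough, as repeated doubling of the accumulator shows; \<open>bound\<close> therefore controls
  the result after every prefix of the list.\<close>

lemma poly_time_fold:
  assumes f: "poly_time (\<lambda>z. f (car z) (car (cdr z)) (cdr (cdr z)))"
    and l: "poly_time l" and s: "poly_time s" and B: "poly_bounded B"
    and bound: "\<And>x ys zs. dec_list (l x) = ys @ zs \<Longrightarrow> nodes (fold (f x) ys (s x)) \<le> B x"
  shows "poly_time (\<lambda>x. fold (f x) (dec_list (l x)) (s x))"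
proof -
  define step where "step = (\<lambda>z. Dot (car z) (Dot (cdr (car (cdr z)))
      (f (car z) (car (car (cdr z))) (cdr (cdr z)))))"
  \<comment> \<open>\<open>pack\<close> replaces the remaining list in a state by its head, which
    gives the argument format assumed for \<open>f\<close>.\<close>
  define pack where "pack = (\<lambda>z. Dot (car z) (Dot (car (car (cdr z))) (cdr (cdr z))))"
  have "poly_time pack"
    unfolding pack_def by (intro poly_time_basic)
  from poly_time_comp[OF f this] have "poly_time step"
    unfolding step_def pack_def by (auto intro!: poly_time_basic)
  then obtain p a c where p: "\<And>z. \<exists>t. exec p z (step z) t \<and> t \<le> a * nodes z ^ c"
    by (rule poly_timeE) blast
  \<comment> \<open>The remaining list is itself the loop test: it is \<open>Atom\<close> exactly
    when nothing is left.\<close>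
  have "poly_time (\<lambda>z. car (cdr z))"
    by (intro poly_time_basic)
  then obtain q a' c' where q: "\<And>z. \<exists>t. exec q z (car (cdr z)) t \<and> t \<le> a' * nodes z ^ c'"
    by (rule poly_timeE) blast
  have "poly_time (\<lambda>x. Dot x (Dot (l x) (s x)))"
    by (intro poly_time_basic l s)
  then obtain r b where r: "poly_bounded b"
      "\<And>x. \<exists>t. exec r x (Dot x (Dot (l x) (s x))) t \<and> t \<le> b x"
    unfolding poly_time_def by blast
  \<comment> \<open>\<open>M\<close> bounds all states that the loop visits, so each of the
    \<open>length ys + 1\<close> rounds, the final test included, has the same cost bound.\<close>
  have loop: "\<exists>t. exec (Loop q p) (Dot x (Dot (enc_list ys) u))
        (Dot x (Dot Atom (fold (f x) ys u))) t \<and>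
      t \<le> (length ys + 1) * (1 + a' * M ^ c' + a * M ^ c)"
    if "\<And>vs ws. ys = vs @ ws \<Longrightarrow> nodes (Dot x (Dot (enc_list ws) (fold (f x) vs u))) \<le> M"
    for x ys u M
    using that
  proof (induction ys arbitrary: u)
    case Nil
    let ?z = "Dot x (Dot Atom u)"
    obtain t where t: "exec q ?z Atom t" "t \<le> a' * nodes ?z ^ c'"
      using q[of ?z] by auto
    have "nodes ?z ^ c' \<le> M ^ c'"
      using Nil.prems[of "[]" "[]"] by (intro power_mono) auto
    then have "t \<le> a' * M ^ c'"
      using t(2) by (meson mult_le_mono2 order_trans)
    with t(1) show ?case
      using exec_Loop_Stop[of q ?z t p] by (intro exI[of _ "1 + t"]) auto
  next
    case (Cons y ys)
    let ?z = "Dot x (Dot (enc_list (y # ys)) u)"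
    have M: "nodes ?z \<le> M"
      using Cons.prems[of "[]" "y # ys"] by simp
    obtain t where t: "exec q ?z (Dot y (enc_list ys)) t" "t \<le> a' * nodes ?z ^ c'"
      using q[of ?z] by auto
    obtain t' where t': "exec p ?z (Dot x (Dot (enc_list ys) (f x y u))) t'" "t' \<le> a * nodes ?z ^ c"
      using p[of ?z] by (auto simp: step_def)
    have "nodes (Dot x (Dot (enc_list ws) (fold (f x) vs (f x y u)))) \<le> M"
      if "ys = vs @ ws" for vs ws
      using Cons.prems[of "y # vs" ws] that by simp
    from Cons.IH[OF this] obtain t'' where t'':
      "exec (Loop q p) (Dot x (Dot (enc_list ys) (f x y u)))
        (Dot x (Dot Atom (fold (f x) ys (f x y u)))) t''"
      "t'' \<le> (length ys + 1) * (1 + a' * M ^ c' + a * M ^ c)"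
      by blast
    have "nodes ?z ^ c' \<le> M ^ c'" "nodes ?z ^ c \<le> M ^ c"
      using M by (simp_all only: power_mono le0)
    then have "t \<le> a' * M ^ c'" "t' \<le> a * M ^ c"
      using t(2) t'(2) by (meson mult_le_mono2 order_trans)+
    then have "1 + t + t' + t'' \<le> (length (y # ys) + 1) * (1 + a' * M ^ c' + a * M ^ c)"
      using t''(2) by (simp only: list.size distrib_right) simp
    moreover have "exec (Loop q p) ?z (Dot x (Dot Atom (fold (f x) (y # ys) u))) (1 + t + t' + t'')"
      using exec_Loop_Step[OF t(1) _ t'(1) t''(1)] by simp
    ultimately show ?case by blast
  qed
  let ?M = "\<lambda>x. 2 + nodes x + nodes (l x) + B x"
  have M: "poly_bounded ?M"
    by (intro poly_bounded_add poly_bounded_const poly_bounded_nodes poly_time_nodes l B)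
  have "poly_time (\<lambda>x. Dot x (Dot Atom (fold (f x) (dec_list (l x)) (s x))))" (is "poly_time ?F")
  proof (rule poly_timeI)
    show "poly_bounded (\<lambda>x. 1 + b x + (nodes (l x) + 1) * (1 + a' * ?M x ^ c' + a * ?M x ^ c))"
      by (intro poly_bounded_add poly_bounded_mult poly_bounded_power poly_bounded_const
          poly_time_nodes l M r(1) poly_bounded_nodes B)
    fix x
    have "nodes (Dot x (Dot (enc_list ws) (fold (f x) vs (s x)))) \<le> ?M x"
      if "dec_list (l x) = vs @ ws" for vs ws
    proof -
      have "l x = enc_list (vs @ ws)"
        using that by (metis enc_dec_list)
      then have "nodes (enc_list ws) \<le> nodes (l x)"
        by (simp add: nodes_enc_list)
      then show ?thesis using bound[OF that] by simp
    qed
    from loop[of "dec_list (l x)", OF this] obtain t where t: "exec (Loop q p) (Dot x (Dot (l x) (s x))) (?F x) t"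
      "t \<le> (length (dec_list (l x)) + 1) * (1 + a' * ?M x ^ c' + a * ?M x ^ c)"
      by auto
    have "(length (dec_list (l x)) + 1) * (1 + a' * ?M x ^ c' + a * ?M x ^ c) \<le>
        (nodes (l x) + 1) * (1 + a' * ?M x ^ c' + a * ?M x ^ c)"
      using length_dec_list[of "l x"] by (intro mult_le_mono1) simp
    moreover obtain u where "exec r x (Dot x (Dot (l x) (s x))) u" "u \<le> b x"
      using r(2) by blast
    ultimately show "\<exists>t. exec (Seq r (Loop q p)) x (?F x) t \<and>
        t \<le> 1 + b x + (nodes (l x) + 1) * (1 + a' * ?M x ^ c' + a * ?M x ^ c)"
      using t by (intro exI[of _ "1 + u + t"] conjI exec_Seq) auto
  qed
  from poly_time_cdr[OF poly_time_cdr[OF this]] show ?thesis by simp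
qed

lemma poly_time_rev:
  assumes "poly_time l"
  shows "poly_time (\<lambda>x. enc_list (rev (dec_list (l x))))"
proof -
  have fold_Dot: "fold Dot ys (enc_list zs) = enc_list (rev ys @ zs)" for ys zs
    by (induction ys arbitrary: zs) (simp_all flip: enc_list.simps)
  have "poly_time (\<lambda>x. fold Dot (dec_list (l x)) Atom)"
  proof (rule poly_time_fold)
    show "poly_bounded (\<lambda>x. nodes (l x))"
      by (intro poly_time_nodes assms)
    show "nodes (fold Dot ys Atom) \<le> nodes (l x)" if "dec_list (l x) = ys @ zs" for x ys zs
    proof -
      have "l x = enc_list (ys @ zs)"
        using that by (metis enc_dec_list)
      then show ?thesis
        using fold_Dot[of ys "[]"] by (simp add: nodes_enc_list flip: rev_map)
    qed
  qed (intro poly_time_basic assms)+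
  then show ?thesis
    using fold_Dot[of _ "[]"] by simp
qed

lemma poly_time_foldr:
  assumes f: "poly_time (\<lambda>z. f (car z) (car (cdr z)) (cdr (cdr z)))"
    and l: "poly_time l" and s: "poly_time s" and B: "poly_bounded B"
    and bound: "\<And>x ys zs. dec_list (l x) = ys @ zs \<Longrightarrow> nodes (foldr (f x) zs (s x)) \<le> B x"
  shows "poly_time (\<lambda>x. foldr (f x) (dec_list (l x)) (s x))"
proof -
  have "poly_time (\<lambda>x. fold (f x) (dec_list (enc_list (rev (dec_list (l x))))) (s x))"
  proof (rule poly_time_fold[OF f poly_time_rev[OF l] s B])
    fix x ys zs
    assume "dec_list (enc_list (rev (dec_list (l x)))) = ys @ zs"
    then have "dec_list (l x) = rev zs @ rev ys"
      by (simp add: rev_swap)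
    from bound[OF this] show "nodes (fold (f x) ys (s x)) \<le> B x"
      by (simp add: foldr_conv_fold)
  qed
  then show ?thesis
    by (simp add: foldr_conv_fold)
qed

text \<open>If a step enlarges the accumulator by an amount that depends on \<open>x\<close> and
  \<open>a\<close> only, the total growth is at most the list length times a polynomial. This
  settles the size condition of \<open>poly_time_foldr\<close>.\<close>

lemma poly_time_foldr_add:
  assumes f: "poly_time (\<lambda>z. f (car z) (car (cdr z)) (cdr (cdr z)))"
    and l: "poly_time l" and s: "poly_time s" and D: "poly_bounded D"
    and step: "\<And>x a u. nodes (f x a u) \<le> nodes u + D (Dot x a)"
  shows "poly_time (\<lambda>x. foldr (f x) (dec_list (l x)) (s x))"
proof -
  obtain a c where D: "\<And>x. D x \<le> a * nodes x ^ c"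
    using D unfolding poly_bounded_def by blast
  let ?d = "\<lambda>x. a * (1 + nodes x + nodes (l x)) ^ c"
  show ?thesis
  proof (rule poly_time_foldr[OF f l s])
    show "poly_bounded (\<lambda>x. nodes (s x) + nodes (l x) * ?d x)"
      by (intro poly_bounded_add poly_bounded_mult poly_bounded_power poly_bounded_const
          poly_bounded_nodes poly_time_nodes l s)
    fix x ys zs
    assume l: "dec_list (l x) = ys @ zs"
    then have zs: "set zs \<subseteq> set (dec_list (l x))"
      by simp
    then have "nodes (foldr (f x) zs (s x)) \<le> nodes (s x) + length zs * ?d x"
    proof (induction zs)
      case (Cons z zs)
      have "D (Dot x z) \<le> a * nodes (Dot x z) ^ c"
        by (rule D)
      also have "\<dots> \<le> ?d x"
        using nodes_member_list[of z "l x"] Cons.prems by (intro mult_le_mono2 power_mono) auto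
      finally have "D (Dot x z) \<le> ?d x" .
      with step[of x z "foldr (f x) zs (s x)"] Cons show ?case
        by simp
    qed simp
    moreover have "length zs \<le> nodes (l x)"
      using length_dec_list[of "l x"] l by simp
    then have "length zs * ?d x \<le> nodes (l x) * ?d x"
      by (rule mult_le_mono1)
    ultimately show "nodes (foldr (f x) zs (s x)) \<le> nodes (s x) + nodes (l x) * ?d x"
      by linarith
  qed
qed

section \<open>Append, drop and concatenating map as programs\<close>

definition append_sexp :: "sexp \<Rightarrow> sexp \<Rightarrow> sexp" where
  "append_sexp l m = foldr Dot (dec_list l) m"

text \<open>The first list serves as a unary number through its length. In particular,
  \<open>drop_sexp l m \<noteq> Atom\<close> tests whether \<open>m\<close> is longer than
  \<open>l\<close>.\<close>

definition drop_sexp :: "sexp \<Rightarrow> sexp \<Rightarrow> sexp" where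
  "drop_sexp l m = foldr (\<lambda>_. cdr) (dec_list l) m"

definition concat_map_sexp :: "(sexp \<Rightarrow> sexp) \<Rightarrow> sexp \<Rightarrow> sexp" where
  "concat_map_sexp f l = foldr (\<lambda>a. append_sexp (f a)) (dec_list l) Atom"

lemma append_sexp: "append_sexp l m = enc_list (dec_list l @ dec_list m)"
proof -
  have "foldr Dot ys m = enc_list (ys @ dec_list m)" for ys
    by (induction ys) auto
  then show ?thesis by (simp add: append_sexp_def)
qed

lemma drop_sexp: "drop_sexp l m = enc_list (drop (length (dec_list l)) (dec_list m))"
proof -
  have cdr: "cdr (enc_list xs) = enc_list (tl xs)" for xs
    by (cases xs) auto
  have "foldr (\<lambda>_. cdr) ys m = enc_list (drop (length ys) (dec_list m))" for ys
    by (induction ys) (simp_all add: cdr drop_Suc flip: drop_tl)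
  then show ?thesis by (simp add: drop_sexp_def)
qed

lemma concat_map_sexp:
  "concat_map_sexp f l = enc_list (concat (map (\<lambda>a. dec_list (f a)) (dec_list l)))"
proof -
  have "foldr (\<lambda>a. append_sexp (f a)) ys Atom = enc_list (concat (map (\<lambda>a. dec_list (f a)) ys))" for ys
    by (induction ys) (auto simp: append_sexp)
  then show ?thesis by (simp add: concat_map_sexp_def)
qed

lemma nodes_cdr: "nodes (cdr x) \<le> nodes x"
  by (cases x) auto

lemma poly_time_append:
  assumes "poly_time l" "poly_time m"
  shows "poly_time (\<lambda>x. append_sexp (l x) (m x))"
  unfolding append_sexp_def
proof (rule poly_time_foldr_add[where f = "\<lambda>_. Dot"])
  show "poly_bounded nodes"
    using poly_bounded_nodes by simp
qed (intro poly_time_basic assms | simp)+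

lemma poly_time_drop:
  assumes "poly_time l" "poly_time m"
  shows "poly_time (\<lambda>x. drop_sexp (l x) (m x))"
  unfolding drop_sexp_def
  by (rule poly_time_foldr_add[OF _ assms poly_bounded_const[of 0]])
    (intro poly_time_basic | simp add: nodes_cdr)+

text \<open>\<open>f\<close> is required to be polynomial in the pair of input and element. The body
  can thus refer to the outer input, which allows nested iterations.\<close>

lemma poly_time_concat_map:
  assumes f: "poly_time (\<lambda>z. f (car z) (cdr z))" and "poly_time l"
  shows "poly_time (\<lambda>x. concat_map_sexp (f x) (l x))"
  unfolding concat_map_sexp_def
proof (rule poly_time_foldr_add)
  have "poly_time (\<lambda>z. Dot (car z) (car (cdr z)))"
    by (intro poly_time_basic)
  from poly_time_comp[OF f this]
  show "poly_time (\<lambda>z. append_sexp (f (car z) (car (cdr z))) (cdr (cdr z)))"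
    by (intro poly_time_append poly_time_basic) simp
  show "poly_bounded (\<lambda>z. nodes (f (car z) (cdr z)))"
    by (rule poly_time_nodes[OF f])
  have nodes: "nodes x = 1 + (\<Sum>a\<leftarrow>dec_list x. 1 + nodes a)" for x
    using nodes_enc_list[of "dec_list x"] by simp
  show "nodes (append_sexp (f x a) u) \<le> nodes u + nodes (f (car (Dot x a)) (cdr (Dot x a)))" for x a u
    using nodes[of u] nodes[of "f x a"] by (simp add: append_sexp nodes_enc_list)
qed (intro poly_time_basic assms)+

section \<open>The geometric reduction\<close>

definition plane_point :: "'s list \<Rightarrow> ('s \<Rightarrow> real \<times> real) \<Rightarrow> real list" where
  "plane_point ss \<phi> = concat (map (\<lambda>t. [fst (\<phi> t), snd (\<phi> t)]) ss)"

lemma length_plane_point [simp]: "length (plane_point ss \<phi>) = 2 * length ss"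
  unfolding plane_point_def by (induction ss) auto

lemma plane_point_nth:
  "l < 2 * length ss \<Longrightarrow>
    plane_point ss \<phi> ! l = (if even l then fst (\<phi> (ss ! (l div 2))) else snd (\<phi> (ss ! (l div 2))))"
proof (induction ss arbitrary: l)
  case (Cons s ss)
  consider "l = 0" | "l = 1" | m where "l = Suc (Suc m)"
    by (metis One_nat_def not0_implies_Suc)
  then show ?case
    by cases (use Cons in \<open>auto simp: plane_point_def\<close>)
qed auto

text \<open>Coordinates \<open>2 * m\<close> and \<open>2 * m + 1\<close> make up the plane of
  \<open>ss ! m\<close>, so a statement about all coordinates splits into one per plane. The ternary
  \<open>Q\<close> covers betweenness, with comparisons of two points as special cases.\<close>

lemma plane_point_forall:
  "(\<forall>l < 2 * length ss. Q (plane_point ss \<phi> ! l) (plane_point ss \<psi> ! l) (plane_point ss \<chi> ! l)) \<longleftrightarrow>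
    (\<forall>t \<in> set ss. Q (fst (\<phi> t)) (fst (\<psi> t)) (fst (\<chi> t)) \<and> Q (snd (\<phi> t)) (snd (\<psi> t)) (snd (\<chi> t)))"
  (is "?L \<longleftrightarrow> ?R")
proof
  assume L: ?L
  show ?R
  proof
    fix t assume "t \<in> set ss"
    then obtain m where m: "m < length ss" "t = ss ! m"
      by (metis in_set_conv_nth)
    have "2 * m < 2 * length ss" "Suc (2 * m) < 2 * length ss"
      using m(1) by auto
    with L m show "Q (fst (\<phi> t)) (fst (\<psi> t)) (fst (\<chi> t)) \<and> Q (snd (\<phi> t)) (snd (\<psi> t)) (snd (\<chi> t))"
      using L[rule_format, of "2 * m"] L[rule_format, of "Suc (2 * m)"]
      by (simp add: plane_point_nth)
  qed
next
  assume R: ?R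
  show ?L
  proof (intro allI impI)
    fix l assume l: "l < 2 * length ss"
    then have "ss ! (l div 2) \<in> set ss"
      by (intro nth_mem) auto
    with R l show "Q (plane_point ss \<phi> ! l) (plane_point ss \<psi> ! l) (plane_point ss \<chi> ! l)"
      by (simp add: plane_point_nth)
  qed
qed

text \<open>A box is a product of intervals, so it contains the bounding box of any two of its
  points. This forces red points into a box that selects a forbidden combination of blue
  points.\<close>

lemma axis_parallel_box_between:
  assumes "axis_parallel_box d H" "x \<in> H" "z \<in> H" "length y = d"
    and between: "\<forall>i<d. min (x ! i) (z ! i) \<le> y ! i \<and> y ! i \<le> max (x ! i) (z ! i)"
  shows "y \<in> H"
proof -
  obtain a b where H: "H = {x. length x = d \<and> (\<forall>i<d. a ! i \<le> x ! i \<and> x ! i \<le> b ! i)}"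
    using assms(1) unfolding axis_parallel_box_def by blast
  have "a ! i \<le> y ! i \<and> y ! i \<le> b ! i" if "i < d" for i
  proof -
    have "a ! i \<le> x ! i" "x ! i \<le> b ! i" "a ! i \<le> z ! i" "z ! i \<le> b ! i"
      using assms(2,3) that unfolding H by blast+
    with between that show ?thesis by (meson max.boundedI min.boundedI order_trans)
  qed
  then show ?thesis
    using assms(4) unfolding H by blast
qed

text \<open>\<open>ss\<close> lists the planes in the order of the coordinates; it is a parameter
  because the program generates the slots in decreasing order. By \<open>no_loops\<close>, equal
  vertices count as non-adjacent, so two slots cannot select the same vertex.\<close>

locale clique_gadget =
  fixes k n :: nat and q :: "nat \<Rightarrow> real" and ss :: "nat list" and E :: "nat set set"
  assumes q_mono: "strict_mono q" and q_pos: "q v > 0"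
    and ss: "set ss = {..<k}" "length ss = k"
    and no_loops: "{u} \<notin> E"
begin

text \<open>
  As the points \<open>(q v, 1 / q v)\<close> form an antichain, a box with its lower corner at the origin and its
  upper corner at one of them contains no other.
\<close>

definition blue :: "nat \<Rightarrow> nat \<Rightarrow> real list" where
  "blue i u = plane_point ss (\<lambda>t. if t = i then (q u, 1 / q u) else (0, 0))"

text \<open>In plane \<open>i\<close> this is the upper corner of the bounding box of the blue
  points of \<open>u\<close> and \<open>Suc u\<close>. It lies in the bounding box of those of
  \<open>u\<close> and \<open>v\<close> for every \<open>v > u\<close>, but componentwise below no
  point of the hyperbola that represents a vertex.\<close>

definition red_same :: "nat \<Rightarrow> nat \<Rightarrow> real list" where
  "red_same i u = plane_point ss (\<lambda>t. if t = i then (q (Suc u), 1 / q u) else (0, 0))"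

definition red_pair :: "nat \<Rightarrow> nat \<Rightarrow> nat \<Rightarrow> nat \<Rightarrow> real list" where
  "red_pair i u j v = plane_point ss
     (\<lambda>t. if t = i then (q u, 1 / q u) else if t = j then (q v, 1 / q v) else (0, 0))"

definition blues :: "real list set" where
  "blues = {blue i u |i u. i < k \<and> u < n}"

definition reds :: "real list set" where
  "reds = {red_same i u |i u. i < k \<and> u < n} \<union>
     {red_pair i u j v |i u j v. i < k \<and> j < k \<and> i \<noteq> j \<and> u < n \<and> v < n \<and> {u, v} \<notin> E}"

lemma q_le_iff [simp]: "q u \<le> q v \<longleftrightarrow> u \<le> v"
  by (rule strict_mono_less_eq[OF q_mono])

lemma inverse_q_le_iff [simp]: "1 / q u \<le> 1 / q v \<longleftrightarrow> v \<le> u"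
  using q_pos by (simp add: divide_simps not_less less_imp_neq[symmetric])

lemma q_nonneg [simp]: "0 \<le> q u" "\<not> q u \<le> 0"
  using q_pos[of u] by linarith+

lemma inverse_q_nonneg [simp]: "0 \<le> 1 / q u" "\<not> 1 / q u \<le> 0"
  using q_pos[of u] by (simp_all add: divide_simps)

lemma finite_blues: "finite blues"
proof -
  have "blues = (\<lambda>(i, u). blue i u) ` ({..<k} \<times> {..<n})"
    unfolding blues_def by auto
  then show ?thesis by simp
qed

text \<open>The box reaches from the origin to the point whose part in plane \<open>t\<close> is the
  hyperbola point of \<open>f t\<close>, where \<open>f\<close> enumerates the clique.\<close>

lemma clique_imp_rectangle:
  assumes S: "S \<subseteq> {..<n}" "card S = k" "is_clique E S"
  shows "has_bichromatic_rectangle (2 * k) reds blues k"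
proof -
  have "finite S"
    using S(1) finite_subset by blast
  then obtain f where f: "bij_betw f {0..<k} S"
    using ex_bij_betw_nat_finite S(2) by metis
  have fS: "f i \<in> S" if "i < k" for i
    using f that unfolding bij_betw_def by auto
  then have fn: "f i < n" if "i < k" for i
    using S(1) that by blast
  define a b where "a = plane_point ss (\<lambda>_. (0, 0))"
    and "b = plane_point ss (\<lambda>t. (q (f t), 1 / q (f t)))"
  define H where "H = {x. length x = 2 * k \<and> (\<forall>i<2 * k. a ! i \<le> x ! i \<and> x ! i \<le> b ! i)}"
  have in_H: "plane_point ss \<phi> \<in> H \<longleftrightarrow> (\<forall>t<k. 0 \<le> fst (\<phi> t) \<and> fst (\<phi> t) \<le> q (f t) \<and>
      0 \<le> snd (\<phi> t) \<and> snd (\<phi> t) \<le> 1 / q (f t))" for \<phi>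
    using plane_point_forall[of ss "\<lambda>x y z. x \<le> y \<and> y \<le> z" "\<lambda>_. (0, 0)" \<phi>
        "\<lambda>t. (q (f t), 1 / q (f t))"]
    unfolding H_def a_def b_def ss by (auto simp: ss)
  have "axis_parallel_box (2 * k) H"
    unfolding axis_parallel_box_def
  proof (intro exI conjI)
    show "\<forall>i<2 * k. a ! i \<le> b ! i"
      using plane_point_forall[of ss "\<lambda>x _ z. x \<le> z" "\<lambda>_. (0, 0)" "\<lambda>_. (0, 0)"
          "\<lambda>t. (q (f t), 1 / q (f t))"]
      unfolding a_def b_def ss by simp
  qed (auto simp: H_def a_def b_def ss)
  moreover have "H \<inter> reds = {}"
  proof -
    \<comment> \<open>Membership would require both \<open>Suc u \<le> f i\<close> and
      \<open>f i \<le> u\<close>.\<close>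
    have "red_same i u \<notin> H" if "i < k" for i u
      using that unfolding red_same_def in_H by (auto intro!: exI[of _ i])
    moreover have "red_pair i u j v \<notin> H"
      if "i < k" "j < k" "i \<noteq> j" "{u, v} \<notin> E" for i u j v
    proof
      assume "red_pair i u j v \<in> H"
      \<comment> \<open>The first coordinate gives \<open>u \<le> f i\<close>, its reciprocal
        \<open>f i \<le> u\<close>; likewise for \<open>v\<close> and \<open>f j\<close>.\<close>
      then have *: "\<forall>t<k. t = i \<longrightarrow> u = f t" "\<forall>t<k. t = j \<longrightarrow> v = f t"
        using that unfolding red_pair_def in_H by (auto intro: antisym)
      then have "u = f i" "v = f j"
        using that by auto
      moreover have "f i \<noteq> f j"
        using f that unfolding bij_betw_def inj_on_def by auto
      ultimately have "{u, v} \<in> E"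
        using S(3) fS that unfolding is_clique_def by blast
      then show False using that by blast
    qed
    ultimately show ?thesis unfolding reds_def by blast
  qed
  moreover have "k \<le> card (H \<inter> blues)"
  proof -
    have "inj_on (\<lambda>i. blue i (f i)) {..<k}"
    proof (rule inj_onI)
      fix i j assume ij: "i \<in> {..<k}" "j \<in> {..<k}" "blue i (f i) = blue j (f j)"
      have "\<forall>l<2 * length ss. blue i (f i) ! l = blue j (f j) ! l"
        using ij(3) by simp
      \<comment> \<open>In plane \<open>i\<close> the left point has the positive first coordinate
        \<open>q (f i)\<close>, while the right one has 0 there unless \<open>i = j\<close>.\<close>
      then have "\<forall>t \<in> set ss. fst (if t = i then (q (f i), 1 / q (f i)) else (0, 0)) =
          fst (if t = j then (q (f j), 1 / q (f j)) else (0, 0))"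
        unfolding blue_def
        by (subst (asm) plane_point_forall[of ss "\<lambda>x _ z. x = z" _ "\<lambda>_. (0, 0)"]) blast
      then show "i = j"
        using ij(1) q_pos[of "f i"] unfolding ss by (auto split: if_splits)
    qed
    then have "card ((\<lambda>i. blue i (f i)) ` {..<k}) = k"
      by (simp add: card_image)
    moreover have "(\<lambda>i. blue i (f i)) ` {..<k} \<subseteq> H \<inter> blues"
      using fn unfolding blues_def by (auto simp: blue_def in_H)
    ultimately show ?thesis
      using card_mono[of "H \<inter> blues"] finite_blues by (metis finite_Int)
  qed
  ultimately show ?thesis
    unfolding has_bichromatic_rectangle_def by blast
qed

text \<open>Two blue points in one plane force a point \<open>red_same\<close> into the box, so the
  blue points in it, at least \<open>k\<close> in number, occupy all \<open>k\<close> planes, one in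
  each. For the vertices so chosen, a missing edge would force a point \<open>red_pair\<close> into
  the box.\<close>

lemma rectangle_imp_clique:
  assumes "has_bichromatic_rectangle (2 * k) reds blues k"
  shows "\<exists>S \<subseteq> {..<n}. card S = k \<and> is_clique E S"
proof -
  obtain H where H: "axis_parallel_box (2 * k) H" "H \<inter> reds = {}" "k \<le> card (H \<inter> blues)"
    using assms unfolding has_bichromatic_rectangle_def by blast
  have between: "plane_point ss \<psi> \<in> H"
    if "plane_point ss \<phi> \<in> H" "plane_point ss \<chi> \<in> H"
      "\<And>t. t < k \<Longrightarrow> min (fst (\<phi> t)) (fst (\<chi> t)) \<le> fst (\<psi> t) \<and>
        fst (\<psi> t) \<le> max (fst (\<phi> t)) (fst (\<chi> t)) \<and>
        min (snd (\<phi> t)) (snd (\<chi> t)) \<le> snd (\<psi> t) \<and> snd (\<psi> t) \<le> max (snd (\<phi> t)) (snd (\<chi> t))"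
    for \<phi> \<psi> \<chi>
  proof (rule axis_parallel_box_between[OF H(1) that(1,2)])
    show "\<forall>i<2 * k. min (plane_point ss \<phi> ! i) (plane_point ss \<chi> ! i) \<le> plane_point ss \<psi> ! i \<and>
        plane_point ss \<psi> ! i \<le> max (plane_point ss \<phi> ! i) (plane_point ss \<chi> ! i)"
      using plane_point_forall[of ss "\<lambda>x y z. min x z \<le> y \<and> y \<le> max x z" \<phi> \<psi> \<chi>] that(3)
      unfolding ss by blast
  qed (simp add: ss)
  \<comment> \<open>Blue points are counted through their index pairs:
    \<open>H \<inter> blues\<close> is covered by an image of \<open>A\<close>, and by
    \<open>no_two\<close> the slot determines the pair.\<close>
  define A where "A = {(i, u). i < k \<and> u < n \<and> blue i u \<in> H}"
  have "A \<subseteq> {..<k} \<times> {..<n}"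
    unfolding A_def by auto
  then have "finite A"
    using finite_subset by blast
  have no_two: False if "u < v" "(i, u) \<in> A" "(i, v) \<in> A" for i u v
  proof -
    have "red_same i u \<in> H"
      unfolding red_same_def
      by (rule between[where \<phi> = "\<lambda>t. if t = i then (q u, 1 / q u) else (0, 0)"
            and \<chi> = "\<lambda>t. if t = i then (q v, 1 / q v) else (0, 0)"])
        (use that in \<open>auto simp: A_def blue_def\<close>)
    then show False
      using H(2) that unfolding reds_def A_def by blast
  qed
  have inj: "inj_on fst A"
    by (rule inj_onI) (metis no_two linorder_neqE_nat prod.collapse)
  have "H \<inter> blues \<subseteq> (\<lambda>(i, u). blue i u) ` A"
    unfolding blues_def A_def by auto
  then have "k \<le> card A"
    using H(3) \<open>finite A\<close> by (meson card_image_le card_mono finite_imageI le_trans)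
  then have "k \<le> card (fst ` A)"
    using inj by (simp add: card_image)
  moreover have "fst ` A \<subseteq> {..<k}"
    unfolding A_def by auto
  ultimately have "fst ` A = {..<k}"
    using card_seteq[of "{..<k}" "fst ` A"] by simp
  then have "\<exists>u. (i, u) \<in> A" if "i < k" for i
    using that by (metis imageE lessThan_iff prod.collapse)
  then obtain f where f: "\<And>i. i < k \<Longrightarrow> (i, f i) \<in> A"
    by metis
  have edge: "{f i, f j} \<in> E" if "i < k" "j < k" "i \<noteq> j" for i j
  proof (rule ccontr)
    assume "{f i, f j} \<notin> E"
    then have "red_pair i (f i) j (f j) \<in> reds"
      using that f unfolding reds_def A_def by blast
    \<comment> \<open>This point is the componentwise maximum of the two blue points, since each of
      them is zero in the plane of the other.\<close>
    moreover have "red_pair i (f i) j (f j) \<in> H"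
      unfolding red_pair_def
      by (rule between[where \<phi> = "\<lambda>t. if t = i then (q (f i), 1 / q (f i)) else (0, 0)"
            and \<chi> = "\<lambda>t. if t = j then (q (f j), 1 / q (f j)) else (0, 0)"])
        (use that f in \<open>auto simp: A_def blue_def\<close>)
    ultimately show False
      using H(2) by blast
  qed
  have "f i \<noteq> f j" if "i < k" "j < k" "i \<noteq> j" for i j
    using edge[OF that] no_loops by auto
  then have "inj_on f {..<k}"
    unfolding inj_on_def by auto
  then have "card (f ` {..<k}) = k"
    by (simp add: card_image)
  moreover have "f ` {..<k} \<subseteq> {..<n}"
    using f unfolding A_def by auto
  moreover have "is_clique E (f ` {..<k})"
    unfolding is_clique_def using edge by fastforce
  ultimately show ?thesis by blast
qed

end

section \<open>The reduction as a program\<close>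

abbreviation true_sexp :: sexp where
  "true_sexp \<equiv> Dot Atom Atom"

text \<open>As every digit is true, the same tree serves as a counter through its length and, read
  in binary, as a numeral of value \<open>2 ^ m - 1\<close>. Coordinates are thus written without
  any arithmetic.\<close>

definition unary :: "nat \<Rightarrow> sexp" where
  "unary m = enc_list (replicate m true_sexp)"

lemma unary_simps: "unary 0 = Atom" "unary (Suc m) = Dot true_sexp (unary m)"
  by (simp_all add: unary_def)

lemma length_unary [simp]: "length (dec_list (unary m)) = m"
  by (simp add: unary_def)

lemma nodes_unary: "nodes (unary m) = 1 + 4 * m"
  by (induction m) (simp_all add: unary_simps)

lemma dec_nat_unary: "dec_nat (unary m) + 1 = 2 ^ m"
  by (induction m) (auto simp: unary_simps dec_bool_def)

lemma car_enc_list: "car (enc_list xs) = (if xs = [] then Atom else hd xs)"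
  by (cases xs) auto

text \<open>The accumulator starts as the one-element list of \<open>unary 0\<close>, and every step
  prepends the successor of its head. The final \<open>cdr\<close> removes the surplus index, which
  equals the length.\<close>

definition indices_sexp :: "sexp \<Rightarrow> sexp" where
  "indices_sexp l =
     cdr (foldr (\<lambda>_ s. Dot (Dot true_sexp (car s)) s) (dec_list l) (Dot Atom Atom))"

lemma foldr_indices:
  "foldr (\<lambda>_ s. Dot (Dot true_sexp (car s)) s) ys (Dot Atom Atom) =
    enc_list (map unary (rev [0..<Suc (length ys)]))"
proof (induction ys)
  case (Cons y ys)
  then show ?case by (simp add: car_enc_list unary_simps)
qed (simp add: unary_simps)

lemma indices_sexp:
  "indices_sexp l = enc_list (map unary (rev [0..<length (dec_list l)]))"
  unfolding indices_sexp_def foldr_indices by simp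

text \<open>A step copies the head of the accumulator, so its growth is not governed by input and
  list element alone. The quadratic size bound comes from the closed form in
  \<open>foldr_indices\<close> instead.\<close>

lemma poly_time_indices:
  assumes "poly_time l"
  shows "poly_time (\<lambda>x. indices_sexp (l x))"
  unfolding indices_sexp_def
proof (intro poly_time_cdr poly_time_foldr)
  show "poly_bounded (\<lambda>x. 1 + (nodes (l x) + 1) * (2 + 4 * nodes (l x)))"
    by (intro poly_bounded_add poly_bounded_mult poly_bounded_const poly_time_nodes assms)
  fix x ys zs
  assume "dec_list (l x) = ys @ zs"
  then have zs: "length zs \<le> nodes (l x)"
    using length_dec_list[of "l x"] by simp
  have "(\<Sum>i\<leftarrow>rev [0..<Suc (length zs)]. 1 + nodes (unary i)) \<le>
      (\<Sum>i\<leftarrow>rev [0..<Suc (length zs)]. 2 + 4 * length zs)"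
    by (rule sum_list_mono) (auto simp: nodes_unary)
  also have "\<dots> = (length zs + 1) * (2 + 4 * length zs)"
    by (simp add: sum_list_triv)
  also have "\<dots> \<le> (nodes (l x) + 1) * (2 + 4 * nodes (l x))"
    using zs by (intro mult_le_mono) auto
  finally show "nodes (foldr (\<lambda>_ s. Dot (Dot true_sexp (car s)) s) zs (Dot Atom Atom)) \<le>
      1 + (nodes (l x) + 1) * (2 + 4 * nodes (l x))"
    unfolding foldr_indices nodes_enc_list by (simp add: comp_def)
qed (intro poly_time_basic assms)+

text \<open>
  The conversion of a binary number to unary stops as soon as the result exceeds the length of the
  given list, for otherwise it could take exponential time.
\<close>

definition capped_step :: "sexp \<Rightarrow> sexp \<Rightarrow> sexp \<Rightarrow> sexp" where
  "capped_step G a s = (if drop_sexp G s \<noteq> Atom then s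
     else append_sexp s (append_sexp s (if a \<noteq> Atom then true_sexp else Atom)))"

definition capped_unary :: "sexp \<Rightarrow> sexp \<Rightarrow> sexp" where
  "capped_unary G b = foldr (capped_step G) (dec_list b) Atom"

text \<open>The fold meets the most significant digit first and evaluates by Horner's rule. A value
  of at most \<open>n\<close> grows to at most \<open>2 * n + 1\<close> before it is frozen. From
  then on the invariant only records that both values exceed \<open>n\<close>, which further digits
  preserve.\<close>

lemma foldr_capped_step:
  fixes G
  defines "n \<equiv> length (dec_list G)"
  shows "\<exists>m. foldr (capped_step G) ys Atom = enc_list (replicate m Atom) \<and> m \<le> 2 * n + 1 \<and>
    (m = dec_nat (enc_list ys) \<or> n < m \<and> n < dec_nat (enc_list ys))"
proof (induction ys)
  case (Cons y ys)
  then obtain m where m: "foldr (capped_step G) ys Atom = enc_list (replicate m Atom)"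
    "m \<le> 2 * n + 1" "m = dec_nat (enc_list ys) \<or> n < m \<and> n < dec_nat (enc_list ys)"
    by blast
  let ?b = "if y \<noteq> Atom then 1 else 0 :: nat"
  have step: "capped_step G y (enc_list (replicate m Atom)) =
      enc_list (replicate (if n < m then m else 2 * m + ?b) Atom)"
  proof (cases "n < m")
    case True
    then show ?thesis by (simp add: capped_step_def drop_sexp n_def)
  next
    case False
    then have "capped_step G y (enc_list (replicate m Atom)) =
        enc_list (replicate m Atom @ replicate m Atom @ replicate ?b Atom)"
      by (simp add: capped_step_def drop_sexp append_sexp n_def)
    also have "\<dots> = enc_list (replicate (2 * m + ?b) Atom)"
      by (simp only: mult_2 replicate_add append_assoc)
    finally show ?thesis using False by simp
  qed
  show ?case
    using m(2,3) by (intro exI[of _ "if n < m then m else 2 * m + ?b"])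
      (auto simp: m(1) step dec_bool_def)
qed simp

lemma capped_unary:
  defines "n \<equiv> \<lambda>G. length (dec_list G)"
  shows "n G < n (capped_unary G b) \<and> n G < dec_nat b \<or>
    n (capped_unary G b) \<le> n G \<and> n (capped_unary G b) = dec_nat b"
proof -
  obtain m where "capped_unary G b = enc_list (replicate m Atom)"
    "m = dec_nat b \<or> n G < m \<and> n G < dec_nat b"
    using foldr_capped_step[of G "dec_list b"] unfolding capped_unary_def n_def by auto
  then show ?thesis by (auto simp: n_def)
qed

lemma poly_time_capped_unary:
  assumes "poly_time G" "poly_time b"
  shows "poly_time (\<lambda>x. capped_unary (G x) (b x))"
  unfolding capped_unary_def
proof (rule poly_time_foldr)
  have G: "poly_time (\<lambda>z. G (car z))"
    by (rule poly_time_comp[OF assms(1)]) (intro poly_time_basic)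
  then show "poly_time (\<lambda>z. capped_step (G (car z)) (car (cdr z)) (cdr (cdr z)))"
    unfolding capped_step_def by (intro poly_time_basic poly_time_drop poly_time_append)
  show "poly_bounded (\<lambda>x. 1 + 2 * (2 * nodes (G x) + 1))"
    by (intro poly_bounded_add poly_bounded_mult poly_bounded_const poly_time_nodes assms)
  show "nodes (foldr (capped_step (G x)) zs Atom) \<le> 1 + 2 * (2 * nodes (G x) + 1)" for x zs
  proof -
    obtain m where m: "foldr (capped_step (G x)) zs Atom = enc_list (replicate m Atom)"
      "m \<le> 2 * length (dec_list (G x)) + 1"
      using foldr_capped_step by blast
    then have "m \<le> 2 * nodes (G x) + 1"
      using length_dec_list[of "G x"] by simp
    then show ?thesis
      by (simp add: m(1) nodes_enc_list sum_list_replicate)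
  qed
qed (intro poly_time_basic assms)+

section \<open>Computing the red and blue points\<close>

definition same_length :: "sexp \<Rightarrow> sexp \<Rightarrow> sexp" where
  "same_length l m = (if drop_sexp l m \<noteq> Atom then Atom
     else if drop_sexp m l \<noteq> Atom then Atom else true_sexp)"

lemma same_length:
  "same_length l m \<noteq> Atom \<longleftrightarrow> length (dec_list l) = length (dec_list m)"
  by (auto simp: same_length_def drop_sexp)

text \<open>Dropping too much leaves \<open>Atom\<close>, and \<open>car Atom\<close> is
  \<open>Atom\<close>, so entries beyond the end of a row read as false.\<close>

definition entry_sexp :: "sexp \<Rightarrow> sexp \<Rightarrow> sexp \<Rightarrow> sexp" where
  "entry_sexp G u v = car (drop_sexp v (car (drop_sexp u G)))"

definition adjacent_sexp :: "sexp \<Rightarrow> sexp \<Rightarrow> sexp \<Rightarrow> sexp" where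
  "adjacent_sexp G u v = (if same_length u v \<noteq> Atom then Atom
     else if entry_sexp G u v \<noteq> Atom then true_sexp else entry_sexp G v u)"

text \<open>For unary numbers \<open>u\<close> and \<open>v\<close> this encodes
  \<open>2 ^ (u + 1) - 1\<close> and \<open>1 / (2 ^ (v + 1) - 1)\<close>; the additional digit
  keeps the denominator nonzero. The separate arguments allow for \<open>red_same\<close>, whose two
  coordinates come from different vertices.\<close>

definition block_sexp :: "sexp \<Rightarrow> sexp \<Rightarrow> sexp" where
  "block_sexp u v = Dot (Dot (Dot Atom (Dot true_sexp u)) (unary 1))
     (Dot (Dot (Dot Atom (unary 1)) (Dot true_sexp v)) Atom)"

text \<open>The default block is the list of two \<open>Atom\<close> entries, both of which decode
  to 0. As the test for \<open>i\<close> comes first, points living in one plane are written with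
  \<open>j\<close> equal to \<open>i\<close>.\<close>

definition point_sexp :: "sexp \<Rightarrow> sexp \<Rightarrow> sexp \<Rightarrow> sexp \<Rightarrow> sexp \<Rightarrow> sexp" where
  "point_sexp S i B j C = concat_map_sexp (\<lambda>t. if same_length t i \<noteq> Atom then B
     else if same_length t j \<noteq> Atom then C else Dot Atom (Dot Atom Atom)) S"

definition product_sexp :: "sexp \<Rightarrow> sexp \<Rightarrow> sexp" where
  "product_sexp A B = concat_map_sexp (\<lambda>a. concat_map_sexp (\<lambda>b. Dot (Dot a b) Atom) B) A"

definition blues_sexp :: "sexp \<Rightarrow> sexp \<Rightarrow> sexp" where
  "blues_sexp S V = concat_map_sexp
     (\<lambda>p. Dot (point_sexp S (car p) (block_sexp (cdr p) (cdr p)) (car p) Atom) Atom)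
     (product_sexp S V)"

definition red_sexp :: "sexp \<Rightarrow> sexp \<Rightarrow> sexp \<Rightarrow> sexp \<Rightarrow> sexp \<Rightarrow> sexp \<Rightarrow> sexp" where
  "red_sexp G S i u j v =
     (if same_length i j \<noteq> Atom then Dot (point_sexp S i (block_sexp (Dot true_sexp u) u) i Atom) Atom
      else if adjacent_sexp G u v \<noteq> Atom then Atom
      else Dot (point_sexp S i (block_sexp u u) j (block_sexp v v)) Atom)"

definition reds_sexp :: "sexp \<Rightarrow> sexp \<Rightarrow> sexp \<Rightarrow> sexp" where
  "reds_sexp G S V = concat_map_sexp
     (\<lambda>r. red_sexp G S (car (car r)) (cdr (car r)) (car (cdr r)) (cdr (cdr r)))
     (product_sexp (product_sexp S V) (product_sexp S V))"

text \<open>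
  If \<open>k\<close> exceeds the number of vertices, then the output is a no-instance without points. Otherwise,
  the dimension \<open>2 k\<close> is written by putting a zero bit in front of \<open>k\<close>.
\<close>

definition reduction :: "sexp \<Rightarrow> sexp" where
  "reduction x = (let K = capped_unary (cdr x) (car x); S = indices_sexp K; V = indices_sexp (cdr x)
     in if drop_sexp (cdr x) K \<noteq> Atom then Dot (unary 1) (Dot Atom (Dot Atom Atom))
        else Dot (car x) (Dot (Dot Atom (car x)) (Dot (reds_sexp (cdr x) S V) (blues_sexp S V))))"

section \<open>Running time of the reduction\<close>

lemma poly_time_same_length:
  "poly_time l \<Longrightarrow> poly_time m \<Longrightarrow> poly_time (\<lambda>x. same_length (l x) (m x))"
  unfolding same_length_def by (intro poly_time_basic poly_time_drop)

lemma poly_time_adjacent: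
  "poly_time G \<Longrightarrow> poly_time u \<Longrightarrow> poly_time v \<Longrightarrow> poly_time (\<lambda>x. adjacent_sexp (G x) (u x) (v x))"
  unfolding adjacent_sexp_def entry_sexp_def
  by (intro poly_time_basic poly_time_drop poly_time_same_length)

lemma poly_time_block:
  "poly_time u \<Longrightarrow> poly_time v \<Longrightarrow> poly_time (\<lambda>x. block_sexp (u x) (v x))"
  unfolding block_sexp_def by (intro poly_time_basic)

text \<open>Inside an iteration the outer input is the \<open>car\<close> of the pair of input and
  element; functions of the outer input are used there in this form.\<close>

lemma poly_time_comp_car: "poly_time F \<Longrightarrow> poly_time (\<lambda>z. F (car z))"
  by (rule poly_time_comp[OF _ poly_time_car[OF poly_time_id]])

lemma poly_time_point:
  assumes "poly_time S" "poly_time i" "poly_time B" "poly_time j" "poly_time C"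
  shows "poly_time (\<lambda>x. point_sexp (S x) (i x) (B x) (j x) (C x))"
  unfolding point_sexp_def
  by (intro poly_time_concat_map poly_time_basic poly_time_same_length
      assms assms[THEN poly_time_comp_car])

lemma poly_time_product:
  assumes "poly_time A" "poly_time B"
  shows "poly_time (\<lambda>x. product_sexp (A x) (B x))"
  unfolding product_sexp_def
  by (intro poly_time_concat_map poly_time_basic assms assms[THEN poly_time_comp_car])

lemma poly_time_blues:
  assumes "poly_time S" "poly_time V"
  shows "poly_time (\<lambda>x. blues_sexp (S x) (V x))"
  unfolding blues_sexp_def
  by (intro poly_time_concat_map poly_time_basic poly_time_point poly_time_block poly_time_product
      assms assms[THEN poly_time_comp_car])

lemma poly_time_reds:
  assumes "poly_time G" "poly_time S" "poly_time V"
  shows "poly_time (\<lambda>x. reds_sexp (G x) (S x) (V x))"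
  unfolding reds_sexp_def red_sexp_def
  by (intro poly_time_concat_map poly_time_basic poly_time_point poly_time_block poly_time_product
      poly_time_same_length poly_time_adjacent assms assms[THEN poly_time_comp_car])

text \<open>\<open>poly_time_If\<close> requires both branches to be polynomial on every input. The
  cap guarantees this: the length of \<open>K\<close> is linear in the number of vertices even if
  \<open>k\<close> is huge.\<close>

lemma poly_time_reduction: "poly_time reduction"
proof -
  have "poly_time (\<lambda>x. reduction x)"
    unfolding reduction_def Let_def
    by (intro poly_time_basic poly_time_drop poly_time_reds poly_time_blues poly_time_indices
        poly_time_capped_unary)
  then show ?thesis by simp
qed

section \<open>Correctness of the reduction\<close>

lemma entry_sexp:
  fixes G
  assumes "u < length (dec_list G)"
  defines "M \<equiv> map (map dec_bool \<circ> dec_list) (dec_list G)"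
  shows "entry_sexp G (unary u) (unary v) \<noteq> Atom \<longleftrightarrow> v < length (M ! u) \<and> M ! u ! v"
proof -
  have "entry_sexp G (unary u) (unary v) =
      (if v < length (dec_list (dec_list G ! u)) then dec_list (dec_list G ! u) ! v else Atom)"
    using assms(1) by (simp add: entry_sexp_def drop_sexp car_enc_list hd_drop_conv_nth not_less)
  then show ?thesis
    using assms(1) by (auto simp: M_def dec_bool_def)
qed

lemma adjacent_sexp:
  assumes "u < length (dec_list G)" "v < length (dec_list G)"
  shows "adjacent_sexp G (unary u) (unary v) \<noteq> Atom \<longleftrightarrow> {u, v} \<in> graph_edges G"
proof -
  have pairs: "{u, v} \<in> {{u, v} |u v. u \<in> V \<and> v \<in> V \<and> u \<noteq> v \<and> v < length (M ! u) \<and> M ! u ! v} \<longleftrightarrow>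
      u \<noteq> v \<and> (v < length (M ! u) \<and> M ! u ! v \<or> u < length (M ! v) \<and> M ! v ! u)"
    if "u \<in> V" "v \<in> V" for V :: "nat set" and M :: "bool list list"
    using that by (simp add: doubleton_eq_iff) blast
  have "{u, v} \<in> graph_edges G \<longleftrightarrow> u \<noteq> v \<and>
      (entry_sexp G (unary u) (unary v) \<noteq> Atom \<or> entry_sexp G (unary v) (unary u) \<noteq> Atom)"
    unfolding entry_sexp[OF assms(1)] entry_sexp[OF assms(2)] graph_edges_def Let_def
    by (rule pairs) (use assms in \<open>simp_all add: graph_vertices_def\<close>)
  then show ?thesis
    using same_length[of "unary u" "unary v"] by (simp add: adjacent_sexp_def)
qed

text \<open>The value of \<open>unary (Suc v)\<close> as a binary numeral: exponential in
  \<open>v\<close>, but with only \<open>Suc v\<close> digits.\<close>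

definition coordinate :: "nat \<Rightarrow> real" where
  "coordinate v = 2 ^ Suc v - 1"

abbreviation dec_point :: "sexp \<Rightarrow> real list" where
  "dec_point x \<equiv> map (of_rat \<circ> dec_rat) (dec_list x)"

lemma dec_point_block:
  "dec_point (block_sexp (unary u) (unary v)) = [coordinate u, 1 / coordinate v]"
proof -
  have "of_nat (dec_nat (unary m)) = (2 ^ m - 1 :: rat)" for m
    using dec_nat_unary[of m] by (metis add_diff_cancel_right' of_nat_1 of_nat_add of_nat_numeral of_nat_power)
  note * = this[of "Suc _"]
  show ?thesis
    unfolding block_sexp_def unary_simps(2)[symmetric]
    by (simp del: power_Suc dec_nat.simps add: dec_rat_def dec_int_def dec_bool_def * coordinate_def
        of_rat_diff of_rat_power of_rat_divide unary_simps(1))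
qed

lemma dec_point_point:
  assumes "dec_list S = map unary ss"
  shows "dec_point (point_sexp S (unary i) B (unary j) C) =
    concat (map (\<lambda>t. if t = i then dec_point B else if t = j then dec_point C else [0, 0]) ss)"
proof -
  have "dec_point (if same_length (unary t) (unary i) \<noteq> Atom then B
      else if same_length (unary t) (unary j) \<noteq> Atom then C else Dot Atom (Dot Atom Atom)) =
    (if t = i then dec_point B else if t = j then dec_point C else [0, 0])" for t
    unfolding same_length by (simp add: dec_rat_def)
  then show ?thesis
    by (simp add: point_sexp_def concat_map_sexp map_concat assms comp_def)
qed

lemma set_product_sexp:
  "set (dec_list (product_sexp A B)) =
    (\<lambda>(a, b). Dot a b) ` (set (dec_list A) \<times> set (dec_list B))"
  by (auto simp: product_sexp_def concat_map_sexp)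

lemma dec_points_concat_map:
  "dec_points (concat_map_sexp f l) = (\<Union>a \<in> set (dec_list l). dec_point ` set (dec_list (f a)))"
  by (auto simp: dec_points_def concat_map_sexp)

lemma coordinate_gadget:
  assumes "set ss = {..<k}" "length ss = k"
  shows "clique_gadget k coordinate ss (graph_edges G)"
proof
  show "strict_mono coordinate"
    unfolding strict_mono_Suc_iff by (simp add: coordinate_def)
  show "0 < coordinate v" for v
  proof -
    have "(1 :: real) < 2 ^ Suc v" by (rule one_less_power) auto
    then show ?thesis by (simp add: coordinate_def)
  qed
  show "{u} \<notin> graph_edges G" for u
    by (auto simp: graph_edges_def Let_def)
qed (use assms in auto)

lemma dec_points_sexp:
  fixes k n ss G
  defines "n \<equiv> length (dec_list G)" and "ss \<equiv> rev [0..<k]"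
    and "V \<equiv> enc_list (map unary (rev [0..<length (dec_list G)]))"
    and "S \<equiv> enc_list (map unary (rev [0..<k]))"
  shows "dec_points (blues_sexp S V) = clique_gadget.blues k n coordinate ss"
    and "dec_points (reds_sexp G S V) = clique_gadget.reds k n coordinate ss (graph_edges G)"
proof -
  interpret clique_gadget k n coordinate ss "graph_edges G"
    by (rule coordinate_gadget) (auto simp: ss_def)
  have S: "dec_list S = map unary ss" "set (dec_list S) = unary ` {..<k}"
    and V: "set (dec_list V) = unary ` {..<n}"
    by (auto simp: S_def V_def ss_def n_def)
  have pairs: "set (dec_list (product_sexp S V)) =
      (\<lambda>(i, u). Dot (unary i) (unary u)) ` ({..<k} \<times> {..<n})"
    unfolding set_product_sexp S(2) V by force
  have blue: "dec_point (point_sexp S (unary i) (block_sexp (unary u) (unary u)) (unary i) Atom) =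
      blue i u" for i u
    unfolding dec_point_point[OF S(1)] dec_point_block blue_def plane_point_def
    by (intro arg_cong[of _ _ concat] map_cong) auto
  have same: "dec_point (point_sexp S (unary i) (block_sexp (Dot true_sexp (unary u)) (unary u))
      (unary i) Atom) = red_same i u" for i u
    unfolding dec_point_point[OF S(1)] unary_simps(2)[symmetric] dec_point_block red_same_def
      plane_point_def
    by (intro arg_cong[of _ _ concat] map_cong) auto
  have pair: "dec_point (point_sexp S (unary i) (block_sexp (unary u) (unary u)) (unary j)
      (block_sexp (unary v) (unary v))) = red_pair i u j v" for i u j v
    unfolding dec_point_point[OF S(1)] dec_point_block red_pair_def plane_point_def
    by (intro arg_cong[of _ _ concat] map_cong) auto
  show "dec_points (blues_sexp S V) = blues"
    unfolding blues_sexp_def dec_points_concat_map pairs by (fastforce simp: blue blues_def)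
  have red: "dec_point ` set (dec_list (red_sexp G S (unary i) (unary u) (unary j) (unary v))) =
      (if i = j then {red_same i u} else if {u, v} \<in> graph_edges G then {} else {red_pair i u j v})"
    if "u < n" "v < n" for i u j v
    using same_length[of "unary i" "unary j"] adjacent_sexp[of u G v] that
    by (simp add: red_sexp_def same pair n_def)
  have "dec_points (reds_sexp G S V) = (\<Union>(i, u) \<in> {..<k} \<times> {..<n}. \<Union>(j, v) \<in> {..<k} \<times> {..<n}.
      dec_point ` set (dec_list (red_sexp G S (unary i) (unary u) (unary j) (unary v))))"
    unfolding reds_sexp_def dec_points_concat_map set_product_sexp[of "product_sexp S V"] pairs
    by fastforce
  also have "\<dots> = (\<Union>(i, u) \<in> {..<k} \<times> {..<n}. \<Union>(j, v) \<in> {..<k} \<times> {..<n}.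
      if i = j then {red_same i u} else if {u, v} \<in> graph_edges G then {} else {red_pair i u j v})"
    by (rule SUP_cong[OF refl], clarify, rule SUP_cong[OF refl], clarify, rule red) auto
  \<comment> \<open>\<open>red_same i u\<close> arises when the pair of \<open>i\<close> and
    \<open>u\<close> is combined with itself.\<close>
  also have "\<dots> = reds"
    unfolding reds_def by (fastforce split: if_splits)
  finally show "dec_points (reds_sexp G S V) = reds" .
qed

lemma reduction_correct: "x \<in> fst k_Clique \<longleftrightarrow> reduction x \<in> fst k_d_Bichromatic_Rectangle"
proof -
  define k n K where "k = dec_nat (car x)" and "n = length (dec_list (cdr x))"
    and "K = capped_unary (cdr x) (car x)"
  have clique: "x \<in> fst k_Clique \<longleftrightarrow>
      (\<exists>S \<subseteq> {..<n}. card S = k \<and> is_clique (graph_edges (cdr x)) S)"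
    by (simp add: k_Clique_def graph_vertices_def k_def n_def)
  consider "n < length (dec_list K)" "n < k" | "length (dec_list K) \<le> n" "length (dec_list K) = k"
    using capped_unary[of "cdr x" "car x"] unfolding k_def n_def K_def by blast
  then show ?thesis
  proof cases
    case 1
    have "card S \<noteq> k" if "S \<subseteq> {..<n}" for S
      using card_mono[OF _ that] 1(2) by simp
    then have "x \<notin> fst k_Clique"
      using clique by blast
    moreover have "reduction x = Dot (unary 1) (Dot Atom (Dot Atom Atom))"
      using 1(1) by (simp add: reduction_def Let_def drop_sexp K_def n_def not_le)
    then have "reduction x \<notin> fst k_d_Bichromatic_Rectangle"
      by (simp add: k_d_Bichromatic_Rectangle_def has_bichromatic_rectangle_def dec_points_def
          unary_def dec_bool_def)
    ultimately show ?thesis by blast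
  next
    case 2
    define ss where "ss = rev [0..<k]"
    define V where "V = enc_list (map unary (rev [0..<length (dec_list (cdr x))]))"
    define S where "S = enc_list (map unary (rev [0..<k]))"
    interpret clique_gadget k n coordinate ss "graph_edges (cdr x)"
      by (rule coordinate_gadget) (auto simp: ss_def)
    have points: "dec_points (blues_sexp S V) = blues" "dec_points (reds_sexp (cdr x) S V) = reds"
      unfolding S_def V_def ss_def n_def by (rule dec_points_sexp)+
    have "reduction x = Dot (car x) (Dot (Dot Atom (car x)) (Dot (reds_sexp (cdr x) S V)
        (blues_sexp S V)))"
      using 2 by (simp add: reduction_def Let_def drop_sexp K_def n_def indices_sexp S_def V_def)
    moreover have "\<forall>p \<in> reds \<union> blues. length p = 2 * k"
      unfolding reds_def blues_def
      by (auto simp: red_same_def red_pair_def blue_def ss(2))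
    ultimately have "reduction x \<in> fst k_d_Bichromatic_Rectangle \<longleftrightarrow>
        has_bichromatic_rectangle (2 * k) reds blues k"
      by (simp add: k_d_Bichromatic_Rectangle_def points dec_bool_def k_def)
    then show ?thesis
      unfolding clique using clique_imp_rectangle rectangle_imp_clique by blast
  qed
qed

text \<open>In the main case the left side is \<open>2 * k + k\<close>. In the other case it is 1,
  and \<open>k\<close> is positive because it exceeds the number of vertices. The factor 4 is
  convenient since it amounts to two zero bits in front of a numeral.\<close>

lemma reduction_parameter:
  "snd k_d_Bichromatic_Rectangle (reduction x) \<le> 4 * snd k_Clique x"
  using capped_unary[of "cdr x" "car x"]
  by (auto simp: reduction_def Let_def k_d_Bichromatic_Rectangle_def k_Clique_def drop_sexp
      dec_bool_def unary_def)

section \<open>Composition of reductions\<close>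

lemma poly_time_computable_nat:
  assumes "poly_time F" "\<And>x. dec_nat (F x) = f (dec_nat x)"
  shows "computable_nat f"
  using assms unfolding computable_nat_def poly_time_def by metis

lemma computable_nat_comp:
  assumes "computable_nat f" "computable_nat g"
  shows "computable_nat (\<lambda>n. g (f n))"
  using assms unfolding computable_nat_def by (metis exec_Seq)

text \<open>
  Spreading out the binary digits bounds the square from above, and it is easier to compute than
  the square.
\<close>

fun spread :: "nat \<Rightarrow> nat" where
  "spread n = (if n = 0 then 0 else n mod 2 + 8 * spread (n div 2))"

declare spread.simps [simp del]

lemma spread_bit: "spread (of_bool b + 2 * n) = of_bool b + 8 * spread n"
  by (subst spread.simps) (auto simp: spread.simps[of 0])

text \<open>With last digit \<open>b\<close>, the square of \<open>b + 2 * m\<close> is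
  \<open>b + 4 * b * m + 4 * m ^ 2\<close>, and the middle term is at most \<open>4 * m ^ 2\<close>.
  A factor of 8 per digit absorbs both.\<close>

lemma square_le_spread: "n\<^sup>2 \<le> spread n"
proof (induction n rule: less_induct)
  case (less n)
  show ?case
  proof (cases "n = 0")
    case False
    define m and b :: nat where "m = n div 2" and "b = n mod 2"
    have n: "n = b + 2 * m" and b: "b = 0 \<or> b = 1"
      by (auto simp: m_def b_def)
    have "m < n"
      using False by (simp add: m_def)
    then have "m\<^sup>2 \<le> spread m"
      by (rule less)
    moreover have "n\<^sup>2 = b + 4 * (b * m) + 4 * m\<^sup>2" "b * m \<le> m\<^sup>2"
      using b by (auto simp: n power2_eq_square algebra_simps)
    ultimately have "n\<^sup>2 \<le> b + 8 * spread m"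
      by linarith
    also have "\<dots> = spread n"
      using False by (subst (2) spread.simps) (simp add: m_def b_def)
    finally show ?thesis .
  qed simp
qed

lemma computable_nat_spread: "computable_nat spread"
proof (rule poly_time_computable_nat)
  show "poly_time (\<lambda>x. concat_map_sexp (\<lambda>a. Dot a (Dot Atom (Dot Atom Atom))) x)"
    by (intro poly_time_concat_map poly_time_basic)
  fix x
  have "dec_nat (enc_list (concat (map (\<lambda>a. [a, Atom, Atom]) ys))) = spread (dec_nat (enc_list ys))" for ys
    by (induction ys) (auto simp: dec_bool_def spread_bit spread.simps[of 0])
  from this[of "dec_list x"]
  show "dec_nat (concat_map_sexp (\<lambda>a. Dot a (Dot Atom (Dot Atom Atom))) x) = spread (dec_nat x)"
    by (simp add: concat_map_sexp)
qed

text \<open>Serves to bound the power of \<open>f\<close> that appears in the running time of a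
  composition. Iterating \<open>spread\<close> reaches the exponent \<open>2 ^ Suc c\<close>, which
  is at least \<open>Suc c\<close>.\<close>

lemma computable_nat_power_bound:
  assumes "computable_nat f"
  obtains h where "computable_nat h" "\<And>n. f n ^ Suc c \<le> h n"
proof -
  have "\<exists>h. computable_nat h \<and> (\<forall>n. f n ^ 2 ^ j \<le> h n)" for j
  proof (induction j)
    case 0
    then show ?case using assms by auto
  next
    case (Suc j)
    then obtain h where h: "computable_nat h" "\<And>n. f n ^ 2 ^ j \<le> h n"
      by blast
    have "f n ^ 2 ^ Suc j \<le> spread (h n)" for n
    proof -
      have "f n ^ 2 ^ Suc j = (f n ^ 2 ^ j)\<^sup>2"
        by (simp add: mult.commute flip: power_mult)
      also have "\<dots> \<le> (h n)\<^sup>2"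
        using h(2) by (intro power_mono) auto
      finally show ?thesis
        using square_le_spread order_trans by blast
    qed
    then show ?case
      using computable_nat_comp[OF h(1) computable_nat_spread] by blast
  qed
  then obtain h where h: "computable_nat h" "\<And>n. f n ^ 2 ^ Suc c \<le> h n"
    by blast
  moreover have "f n ^ Suc c \<le> f n ^ 2 ^ Suc c" for n
  proof (cases "f n = 0")
    case False
    have "Suc c \<le> 2 ^ Suc c"
      by (rule less_imp_le) (rule less_exp)
    then show ?thesis
      using False by (intro power_increasing) auto
  qed auto
  ultimately show ?thesis
    using that order_trans by blast
qed

text \<open>The running time of the first reduction bounds its output size, so a subsequent
  polynomial-time map costs at most a fixed power of an fpt bound, which is again of that form.
  Monotonicity of \<open>g\<close> enters because \<open>g'\<close> only bounds the intermediate
  parameter from above.\<close>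

lemma fpt_reducible_poly_time_trans:
  assumes PQ: "fpt_reducible P Q" and R: "poly_time R"
    and correct: "\<And>x. x \<in> fst Q \<longleftrightarrow> R x \<in> fst Q'"
    and g: "computable_nat g" "mono g" and param: "\<And>x. snd Q' (R x) \<le> g (snd Q x)"
  shows "fpt_reducible P Q'"
proof -
  obtain R' g' p f a c where R': "\<And>x. x \<in> fst P \<longleftrightarrow> R' x \<in> fst Q"
    and g': "computable_nat g'" "\<And>x. snd Q (R' x) \<le> g' (snd P x)"
    and f: "computable_nat f"
    and p: "\<And>x. \<exists>t. exec p x (R' x) t \<and> t \<le> a * (f (snd P x) * nodes x ^ c)"
    using PQ unfolding fpt_reducible_def fpt_time_computable_def by metis
  obtain q b d where q: "\<And>x. \<exists>t. exec q x (R x) t \<and> t \<le> b * nodes x ^ d"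
    using R by (rule poly_timeE) blast
  obtain h where h: "computable_nat h" "\<And>n. f n ^ Suc d \<le> h n"
    using computable_nat_power_bound[OF f] by metis
  have time: "\<exists>t. exec (Seq p q) x (R (R' x)) t \<and>
      t \<le> ((2 + b) * a ^ Suc d) * (h (snd P x) * nodes x ^ (c * Suc d))" for x
  proof -
    obtain s where s: "exec p x (R' x) s" "s \<le> a * (f (snd P x) * nodes x ^ c)"
      using p by blast
    obtain t where t: "exec q (R' x) (R (R' x)) t" "t \<le> b * nodes (R' x) ^ d"
      using q by blast
    \<comment> \<open>\<open>T\<close> bounds time and output size of the first reduction. With
      exponent \<open>Suc d\<close> instead of \<open>d\<close>, the power dominates
      \<open>T\<close> itself even when \<open>d = 0\<close>; this leads to the constant
      \<open>2 + b\<close>.\<close>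
    define T where "T = a * (f (snd P x) * nodes x ^ c)"
    have "nodes (R' x) \<le> T" "1 \<le> T"
      using exec_nodes[OF s(1)] s(2) nodes_pos[of x] unfolding T_def by linarith+
    have "nodes (R' x) ^ d \<le> T ^ Suc d"
      using \<open>nodes (R' x) \<le> T\<close> \<open>1 \<le> T\<close>
      by (meson le_SucI order_refl order_trans power_increasing power_mono zero_le)
    then have "t \<le> b * T ^ Suc d"
      using t(2) by (meson mult_le_mono2 order_trans)
    moreover have "1 \<le> T ^ Suc d"
      using \<open>1 \<le> T\<close> by (rule one_le_power)
    moreover have "s \<le> T ^ Suc d"
      using s(2) self_le_power[OF \<open>1 \<le> T\<close>, of "Suc d"] unfolding T_def by linarith
    ultimately have "1 + s + t \<le> (2 + b) * T ^ Suc d"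
      unfolding distrib_right by linarith
    also have "\<dots> = ((2 + b) * a ^ Suc d) * (f (snd P x) ^ Suc d * nodes x ^ (c * Suc d))"
      unfolding T_def by (simp only: power_mult_distrib power_mult mult_ac)
    also have "\<dots> \<le> ((2 + b) * a ^ Suc d) * (h (snd P x) * nodes x ^ (c * Suc d))"
      by (intro mult_le_mono mult_le_mono2 h(2) order_refl)
    finally show ?thesis
      using exec_Seq[OF s(1) t(1)] by blast
  qed
  have "fpt_time_computable (snd P) (\<lambda>x. R (R' x))"
    unfolding fpt_time_computable_def using h(1) time by blast
  moreover have "snd Q' (R (R' x)) \<le> g (g' (snd P x))" for x
    using param g'(2) g(2) by (meson monoD order_trans)
  ultimately show ?thesis
    unfolding fpt_reducible_def using R' correct computable_nat_comp[OF g'(1) g(1)] by meson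
qed

theorem theorem6: "W1_hard k_d_Bichromatic_Rectangle"
  unfolding W1_hard_def
proof
  fix P assume "P \<in> W1"
  then have "fpt_reducible P k_Clique"
    by (simp add: W1_def)
  then show "fpt_reducible P k_d_Bichromatic_Rectangle"
  proof (rule fpt_reducible_poly_time_trans[OF _ poly_time_reduction reduction_correct])
    show "computable_nat (\<lambda>n. 4 * n)"
    proof (rule poly_time_computable_nat)
      show "poly_time (\<lambda>x. Dot Atom (Dot Atom x))"
        by (intro poly_time_basic)
    qed (simp add: dec_bool_def)
    show "mono (\<lambda>n. 4 * n :: nat)"
      by (simp add: mono_def)
  qed (rule reduction_parameter)
qed

end
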